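(* Let $g\in C^{\infty}(\mathcal{S})$. Then $$g(x)=\frac12\sum_{m\in\mathbb{Z}}\hat g(m)e^{\pi i x m}\quad\text{for all }x\in\mathcal{S},$$ where the infinite sum is understood as $\lim_{n\to\infty}S_n(g)(x)$, $n\in\mathbb{N}$, with $S_n(g)(x)=\sum_{m=-n}^{n}\hat g(m)e^{\pi i x m}$. Moreover, the convergence is uniform on $\mathcal{S}$.
   Context: $\mathcal{S}$ is the circle of radius $1/\pi$, modelled by the real interval $[-1,1]$ with the endpoints $-1$ and $1$ identified. $C^{\infty}(\mathcal{S})$ is the set of infinitely differentiable functions $g:\mathcal{S}\to\mathbb{C}$ (in the sense of real manifolds); equivalently, the functions $g:(-1,1)\to\mathbb{C}$ that are infinitely differentiable and such that $g$ and all its derivatives $g^{(n)}$, $n\in\mathbb{N}$, extend to continuous functions on $\mathcal{S}$. For $m\in\mathbb{Z}$, the $m$-th Fourier coefficient of $g$ is $\hat g(m)=\int_{-1}^{1}g(x)e^{-\pi i x m}\,dx$. *)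

theory Defs
  imports "HOL-Analysis.Analysis"
begin

text \<open>
  The circle of radius \<open>1/\<pi>\<close> is the interval \<open>[-1,1]\<close> with \<open>-1\<close> and \<open>1\<close> identified.
  A function on it is a function \<open>real \<Rightarrow> complex\<close> taking the same value at \<open>-1\<close> and \<open>1\<close>;
  its values outside \<open>[-1,1]\<close> are irrelevant.
  By the universal property of the quotient topology, it is continuous on the circle
  iff it is continuous on \<open>[-1,1]\<close>.
\<close>

definition continuous_on_circle :: "(real \<Rightarrow> complex) \<Rightarrow> bool" where
  "continuous_on_circle h \<longleftrightarrow> continuous_on {-1..1} h \<and> h (-1) = h 1"

definition nth_vector_derivative :: "nat \<Rightarrow> (real \<Rightarrow> complex) \<Rightarrow> real \<Rightarrow> complex" where
  "nth_vector_derivative n g = ((\<lambda>f x. vector_derivative f (at x)) ^^ n) g"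

text \<open>
  The iterated derivatives are only evaluated on the open interval \<open>(-1,1)\<close>, where they depend
  only on \<open>g\<close> restricted to \<open>(-1,1)\<close>; smoothness across the identified endpoints is expressed
  by the continuous extension of each derivative to the circle. Continuity of \<open>g\<close> itself says
  that its value at the identified endpoint is the one given by the extension for \<open>n = 0\<close>.
\<close>

definition smooth_on_circle :: "(real \<Rightarrow> complex) \<Rightarrow> bool" where
  "smooth_on_circle g \<longleftrightarrow>
     continuous_on_circle g \<and>
     (\<forall>n. (\<forall>x\<in>{-1<..<1}. nth_vector_derivative n g differentiable (at x)) \<and>
          (\<exists>h. continuous_on_circle h \<and> (\<forall>x\<in>{-1<..<1}. h x = nth_vector_derivative n g x)))"

definition fourier_coeff :: "(real \<Rightarrow> complex) \<Rightarrow> int \<Rightarrow> complex" where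
  "fourier_coeff g m =
     integral {-1..1} (\<lambda>x. g x * exp (- (of_real pi * \<i> * of_real x * of_int m)))"

definition fourier_partial_sum :: "(real \<Rightarrow> complex) \<Rightarrow> nat \<Rightarrow> real \<Rightarrow> complex" where
  "fourier_partial_sum g n x =
     (\<Sum>m\<in>{- int n..int n}. fourier_coeff g m * exp (of_real pi * \<i> * of_real x * of_int m))"

end

theory Submission
  imports Defs
begin

text \<open>
  Write \<open>c(m)\<close> for the \<open>m\<close>-th Fourier coefficient of \<open>g\<close> and \<open>e(x) = exp (\<pi> \<i> x)\<close>. The proof has
  two independent halves: the partial sums converge uniformly to something, and that something is
  \<open>2 g\<close>.

  Integrating by parts twice gives \<open>|c(m)| \<le> C / m\<^sup>2\<close> (\<open>fourier_coeff_quadratic_decay\<close>), where the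
  first boundary term cancels because \<open>g\<close> agrees at \<open>-1\<close> and \<open>1\<close>. The Weierstrass M-test then
  yields uniform convergence to a continuous function.

  The limit is identified at an interior point \<open>x0\<close> by a telescoping argument in place of an
  estimate on the Dirichlet kernel. Write \<open>g(x) - g(x0) = (e(x) - e(x0)) q(x)\<close>. On \<open>[-1,1]\<close> the
  factor \<open>e(x) - e(x0)\<close> has a single simple zero, at \<open>x0\<close>, so \<open>q\<close> is continuous there
  (\<open>divide_by_character_difference\<close>). If \<open>d(m)\<close> are the coefficients of \<open>q\<close>, this product says that
  \<open>c(m) = d(m - 1) - e(x0) d(m)\<close>, with an additional \<open>2 g(x0)\<close> for \<open>m = 0\<close>. Hence the partial sum at
  \<open>x0\<close> telescopes to \<open>2 g(x0)\<close> plus two boundary terms (\<open>fourier_partial_sum_telescope\<close>), which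
  vanish in the limit by the Riemann--Lebesgue lemma for the continuous function \<open>q\<close>. The endpoints
  \<open>-1\<close> and \<open>1\<close> follow because both \<open>g\<close> and the limit are continuous on \<open>[-1,1]\<close>.
\<close>

section \<open>Characters of the circle\<close>

definition character :: "int \<Rightarrow> real \<Rightarrow> complex" where
  "character m x = exp (of_real pi * \<i> * of_real x * of_int m)"

lemma fourier_coeff_character:
  "fourier_coeff f m = integral {-1..1} (\<lambda>x. f x * character (- m) x)"
  by (simp add: fourier_coeff_def character_def)

lemma fourier_partial_sum_character:
  "fourier_partial_sum f n x = (\<Sum>m\<in>{- int n..int n}. fourier_coeff f m * character m x)"
  by (simp add: fourier_partial_sum_def character_def)

lemma character_add: "character (m + k) x = character m x * character k x"
  by (simp add: character_def exp_add [symmetric] algebra_simps)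

lemma character_0 [simp]: "character 0 x = 1"
  by (simp add: character_def)

lemma norm_character [simp]: "norm (character m x) = 1"
  by (simp add: character_def)

lemma character_nonzero [simp]: "character m x \<noteq> 0"
  by (simp add: character_def)

lemma tendsto_zero_times_character:
  assumes "(f \<longlongrightarrow> 0) F"
  shows "((\<lambda>n. f n * character (k n) x) \<longlongrightarrow> 0) F"
proof (rule tendsto_norm_zero_cancel)
  show "((\<lambda>n. norm (f n * character (k n) x)) \<longlongrightarrow> 0) F"
    using tendsto_norm_zero [OF assms] by (simp add: norm_mult)
qed

lemma continuous_on_character [continuous_intros]: "continuous_on S (character m)"
  unfolding character_def by (intro continuous_intros)

lemma character_has_vector_derivative:
  "(character m has_vector_derivative (of_real pi * \<i> * of_int m * character m x)) (at x)"
proof -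
  have "((\<lambda>z. exp (of_real pi * \<i> * z * of_int m)) has_field_derivative
          (of_real pi * \<i> * of_int m * character m x)) (at (of_real x))"
    unfolding character_def by (auto intro!: derivative_eq_intros simp: algebra_simps)
  from has_vector_derivative_real_field [OF this] show ?thesis
    by (simp add: character_def [abs_def])
qed

lemma character_endpoints: "character m (-1) = character m 1"
proof -
  have "of_real pi * \<i> * of_real (-1) * of_int m + of_int (2 * m) * of_real pi * \<i>
        = of_real pi * \<i> * of_real 1 * (of_int m :: complex)"
    by (simp add: algebra_simps)
  then show ?thesis
    unfolding character_def exp_eq by (intro exI [of _ "- m"]) (simp add: algebra_simps)
qed

lemma character_1_eq_iff:
  assumes "x \<in> {-1..1}" "y \<in> {-1<..<1}"
  shows "character 1 x = character 1 y \<longleftrightarrow> x = y"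
proof
  assume "character 1 x = character 1 y"
  then obtain n :: int
    where n: "of_real pi * \<i> * of_real x = of_real pi * \<i> * of_real y + of_int (2 * n) * of_real pi * \<i>"
    unfolding character_def exp_eq by (auto simp: algebra_simps)
  have "of_real pi * \<i> * of_real x = of_real pi * \<i> * (complex_of_real (y + 2 * of_int n))"
    using n by (simp add: algebra_simps)
  then have "complex_of_real x = complex_of_real (y + 2 * of_int n)"
    unfolding mult_cancel_left by simp
  then have eq: "x = y + 2 * of_int n"
    unfolding of_real_eq_iff .
  have "\<bar>real_of_int n\<bar> < 1"
    using eq assms by auto
  then have "n = 0"
    by linarith
  then show "x = y"
    using eq by simp
qed simp

section \<open>Fourier coefficients of continuous functions\<close>

lemma integrable_times_character:
  assumes "continuous_on {-1..1} f"
  shows "(\<lambda>x. f x * character m x) integrable_on {-1..1}"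
  by (intro integrable_continuous_interval continuous_intros assms)

lemma norm_fourier_coeff_le:
  assumes "continuous_on {-1..1} f" and "\<And>x. x \<in> {-1..1} \<Longrightarrow> norm (f x) \<le> B"
  shows "norm (fourier_coeff f m) \<le> 2 * B"
proof -
  have "norm (integral {-1..1} (\<lambda>x. f x * character (- m) x)) \<le> B * (1 - (-1))"
    by (rule integral_bound) (auto intro!: continuous_intros assms simp: norm_mult)
  then show ?thesis
    by (simp add: fourier_coeff_character)
qed

lemma fourier_coeff_diff:
  assumes "continuous_on {-1..1} f" "continuous_on {-1..1} g"
  shows "fourier_coeff (\<lambda>x. f x - g x) m = fourier_coeff f m - fourier_coeff g m"
  using assms
  by (simp add: fourier_coeff_character left_diff_distrib integral_diff integrable_times_character)

lemma fourier_coeff_by_parts: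
  assumes f: "continuous_on {-1..1} f" and f': "continuous_on {-1..1} f'"
    and deriv: "\<And>x. x \<in> {-1<..<1} \<Longrightarrow> (f has_vector_derivative f' x) (at x)"
  shows "of_real pi * \<i> * of_int m * fourier_coeff f m
         = fourier_coeff f' m - (f 1 - f (-1)) * character m 1"
proof -
  let ?c = "of_real pi * \<i> * of_int m :: complex"
  have "((\<lambda>x. f x * (of_real pi * \<i> * of_int (- m) * character (- m) x) + f' x * character (- m) x)
          has_integral (f 1 * character (- m) 1 - f (-1) * character (- m) (-1))) {-1..1}"
  proof (rule fundamental_theorem_of_calculus_interior)
    show "continuous_on {-1..1} (\<lambda>x. f x * character (- m) x)"
      by (intro continuous_intros f)
    show "((\<lambda>x. f x * character (- m) x) has_vector_derivative
            f x * (of_real pi * \<i> * of_int (- m) * character (- m) x) + f' x * character (- m) x) (at x)"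
      if "x \<in> {-1<..<1}" for x
      by (rule has_vector_derivative_mult [OF deriv [OF that] character_has_vector_derivative])
  qed simp
  moreover have "character (- m) 1 = character m 1"
    using character_endpoints [of m] by (simp add: character_def)
  ultimately have "((\<lambda>x. f' x * character (- m) x - ?c * (f x * character (- m) x))
          has_integral ((f 1 - f (-1)) * character m 1)) {-1..1}"
    by (simp add: character_endpoints algebra_simps)
  moreover have "((\<lambda>x. f' x * character (- m) x - ?c * (f x * character (- m) x))
          has_integral (fourier_coeff f' m - ?c * fourier_coeff f m)) {-1..1}"
    unfolding fourier_coeff_character
    by (intro has_integral_diff has_integral_mult_right integrable_integral
          integrable_times_character f f')
  ultimately have "(f 1 - f (-1)) * character m 1 = fourier_coeff f' m - ?c * fourier_coeff f m"
    by (rule has_integral_unique)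
  then show ?thesis
    by (simp add: algebra_simps)
qed

lemma fourier_coeff_const: "fourier_coeff (\<lambda>x. c) m = (if m = 0 then 2 * c else 0)"
proof (cases "m = 0")
  case True
  then show ?thesis
    by (simp add: fourier_coeff_character scaleR_conv_of_real)
next
  case False
  have "of_real pi * \<i> * of_int m * fourier_coeff (\<lambda>x. c) m = fourier_coeff (\<lambda>x. 0) m"
    by (subst fourier_coeff_by_parts [where f' = "\<lambda>x. 0"]) auto
  then show ?thesis
    using False by (simp add: fourier_coeff_character)
qed

text \<open>
  One integration by parts turns a continuous derivative into decay of order \<open>1 / |m|\<close>; the
  boundary term does not vanish in general, but it is bounded in \<open>m\<close>.
\<close>

lemma fourier_coeff_linear_decay:
  assumes f: "continuous_on {-1..1} f" and f': "continuous_on {-1..1} f'"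
    and deriv: "\<And>x. x \<in> {-1<..<1} \<Longrightarrow> (f has_vector_derivative f' x) (at x)"
  obtains C where "\<And>m. \<bar>of_int m\<bar> * norm (fourier_coeff f m) \<le> C"
proof -
  have "bounded (f' ` {-1..1})"
    by (intro compact_imp_bounded compact_continuous_image f') auto
  then obtain B where "\<forall>y\<in>f' ` {-1..1}. norm y \<le> B"
    unfolding bounded_iff by blast
  then have B: "norm (f' x) \<le> B" if "x \<in> {-1..1}" for x
    using that by blast
  show thesis
  proof
    fix m :: int
    have "\<bar>of_int m\<bar> * norm (fourier_coeff f m) \<le> pi * \<bar>of_int m\<bar> * norm (fourier_coeff f m)"
      using pi_ge_two by (intro mult_right_mono) (auto intro: mult_le_cancel_right1 [THEN iffD2])
    also have "\<dots> = norm (of_real pi * \<i> * of_int m * fourier_coeff f m)"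
      by (simp add: norm_mult)
    also have "\<dots> \<le> norm (fourier_coeff f' m) + norm ((f 1 - f (-1)) * character m 1)"
      using fourier_coeff_by_parts [OF f f' deriv, of m] by (metis norm_triangle_ineq4)
    also have "\<dots> \<le> 2 * B + norm (f 1 - f (-1))"
      using norm_fourier_coeff_le [OF f' B] by (simp add: norm_mult)
    finally show "\<bar>of_int m\<bar> * norm (fourier_coeff f m) \<le> 2 * B + norm (f 1 - f (-1))" .
  qed
qed

text \<open>
  Riemann--Lebesgue: the coefficients of a polynomial decay by the previous lemma, and replacing
  \<open>f\<close> by a uniformly close polynomial changes all coefficients by a small amount, uniformly in the
  index.
\<close>

lemma riemann_lebesgue:
  assumes f: "continuous_on {-1..1} f" and k: "filterlim (\<lambda>n. \<bar>k n\<bar>) at_top F"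
  shows "((\<lambda>n. fourier_coeff f (k n)) \<longlongrightarrow> 0) F"
proof (rule tendstoI)
  fix e :: real
  assume e: "e > 0"
  obtain p where p: "polynomial_function p" and fp: "\<And>x. x \<in> {-1..1} \<Longrightarrow> norm (f x - p x) < e / 4"
    using Stone_Weierstrass_polynomial_function [OF compact_Icc f, of "e / 4"] e by auto
  obtain p' where p': "polynomial_function p'" and deriv: "\<And>x. (p has_vector_derivative p' x) (at x)"
    using has_vector_derivative_polynomial_function [OF p] by blast
  have cont: "continuous_on {-1..1} p" "continuous_on {-1..1} p'"
    using p p' by (auto intro: continuous_on_polymonial_function)
  obtain C where C: "\<And>m. \<bar>of_int m\<bar> * norm (fourier_coeff p m) \<le> C"
    using fourier_coeff_linear_decay [OF cont deriv] by blast
  have "\<forall>\<^sub>F n in F. \<lceil>2 * \<bar>C\<bar> / e\<rceil> + 1 \<le> \<bar>k n\<bar>"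
    using k by (simp add: filterlim_at_top)
  then show "\<forall>\<^sub>F n in F. dist (fourier_coeff f (k n)) 0 < e"
  proof eventually_elim
    case (elim n)
    have large: "2 * \<bar>C\<bar> / e < \<bar>of_int (k n)\<bar>"
      using elim by linarith
    then have pos: "\<bar>real_of_int (k n)\<bar> > 0"
      using e by (smt (verit) divide_nonneg_pos)
    have "norm (fourier_coeff p (k n)) \<le> C / \<bar>of_int (k n)\<bar>"
      using C [of "k n"] pos by (simp add: field_simps)
    also have "\<dots> < e / 2"
      using large pos e by (simp add: field_simps)
    finally have "norm (fourier_coeff p (k n)) < e / 2" .
    moreover have "norm (fourier_coeff (\<lambda>x. f x - p x) (k n)) \<le> 2 * (e / 4)"
      by (rule norm_fourier_coeff_le) (intro continuous_intros f cont, rule less_imp_le [OF fp])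
    then have "norm (fourier_coeff f (k n) - fourier_coeff p (k n)) \<le> e / 2"
      by (simp add: fourier_coeff_diff f cont)
    ultimately have "norm (fourier_coeff f (k n)) < e"
      by norm
    then show ?case
      by simp
  qed
qed

section \<open>Pointwise convergence at an interior point\<close>

lemma has_vector_derivative_slope:
  fixes f :: "real \<Rightarrow> complex"
  assumes "(f has_vector_derivative D) (at x)"
  shows "((\<lambda>y. (f y - f x) / of_real (y - x)) \<longlongrightarrow> D) (at x)"
proof -
  have "((\<lambda>y. norm (f y - f x - (y - x) *\<^sub>R D) / norm (y - x)) \<longlongrightarrow> 0) (at x)"
    using assms unfolding has_vector_derivative_def has_derivative_iff_norm by blast
  moreover have "\<forall>\<^sub>F y in at x. norm (f y - f x - (y - x) *\<^sub>R D) / norm (y - x)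
                   = norm ((f y - f x) / of_real (y - x) - D)"
    unfolding eventually_at_filter
  proof (intro always_eventually allI impI)
    fix y assume "y \<noteq> x"
    then have "(f y - f x) / of_real (y - x) - D = (f y - f x - (y - x) *\<^sub>R D) / of_real (y - x)"
      by (simp add: divide_simps scaleR_conv_of_real del: of_real_diff)
    then show "norm (f y - f x - (y - x) *\<^sub>R D) / norm (y - x)
                 = norm ((f y - f x) / of_real (y - x) - D)"
      by (simp add: norm_divide del: of_real_diff)
  qed
  ultimately have "((\<lambda>y. norm ((f y - f x) / of_real (y - x) - D)) \<longlongrightarrow> 0) (at x)"
    by (rule Lim_transform_eventually)
  then have "((\<lambda>y. (f y - f x) / of_real (y - x) - D) \<longlongrightarrow> 0) (at x)"
    by (rule tendsto_norm_zero_cancel)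
  then show ?thesis
    by (rule LIM_zero_cancel)
qed

text \<open>
  The quotient of \<open>g(x) - g(x0)\<close> by \<open>e(x) - e(x0)\<close> extends continuously over \<open>x0\<close>: its limit there
  is the ratio of the two derivatives, and \<open>e\<close> has nonzero derivative.
\<close>

lemma divide_by_character_difference:
  assumes g: "continuous_on {-1..1} g" and x0: "x0 \<in> {-1<..<1}"
    and D: "(g has_vector_derivative D) (at x0)"
  obtains q where "continuous_on {-1..1} q"
    and "\<And>x. x \<in> {-1..1} \<Longrightarrow> g x - g x0 = (character 1 x - character 1 x0) * q x"
proof -
  define E where "E = of_real pi * \<i> * character 1 x0"
  define r where "r = (\<lambda>x. (g x - g x0) / (character 1 x - character 1 x0))"
  define q where "q = (\<lambda>x. if x = x0 then D / E else r x)"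
  have E: "(character 1 has_vector_derivative E) (at x0)"
    using character_has_vector_derivative [of 1 x0] by (simp add: E_def)
  have "((\<lambda>y. ((g y - g x0) / of_real (y - x0)) /
               ((character 1 y - character 1 x0) / of_real (y - x0))) \<longlongrightarrow> D / E) (at x0)"
    by (intro tendsto_divide has_vector_derivative_slope D E) (simp add: E_def)
  moreover have "\<forall>\<^sub>F y in at x0. ((g y - g x0) / of_real (y - x0)) /
               ((character 1 y - character 1 x0) / of_real (y - x0)) = q y"
    unfolding eventually_at_filter by (auto simp: q_def r_def)
  ultimately have lim: "(q \<longlongrightarrow> D / E) (at x0)"
    by (rule Lim_transform_eventually)
  have "continuous_on {-1..1} q"
    unfolding continuous_on_eq_continuous_within
  proof
    fix x :: real
    assume x: "x \<in> {-1..1}"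
    show "continuous (at x within {-1..1}) q"
    proof (cases "x = x0")
      case True
      then show ?thesis
        using lim by (auto simp: continuous_within q_def intro: tendsto_within_subset)
    next
      case False
      have "continuous_on ({-1..1} - {x0}) r"
        unfolding r_def using x0
        by (intro continuous_intros continuous_on_subset [OF g]) (auto simp: character_1_eq_iff)
      then have "continuous_on ({-1..1} - {x0}) q"
        by (rule continuous_on_eq) (auto simp: q_def)
      then have "continuous (at x within {-1..1} - {x0}) q"
        using x False by (simp add: continuous_on_eq_continuous_within)
      moreover have "at x within {-1..1} - {x0} = at x within {-1..1}"
        using False by (intro at_within_nhd [of x "- {x0}"]) auto
      ultimately show ?thesis
        by simp
    qed
  qed
  moreover have "g x - g x0 = (character 1 x - character 1 x0) * q x" if "x \<in> {-1..1}" for x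
    using character_1_eq_iff [OF that x0] by (simp add: q_def r_def)
  ultimately show thesis
    by (rule that)
qed

text \<open>
  Multiplication by \<open>e\<close> shifts the Fourier coefficients by one, so multiplication by
  \<open>e - e(x0)\<close> takes a twisted difference of neighbouring coefficients.
\<close>

lemma fourier_coeff_of_quotient:
  assumes g: "continuous_on {-1..1} g" and q: "continuous_on {-1..1} q"
    and gq: "\<And>x. x \<in> {-1..1} \<Longrightarrow> g x - g x0 = (character 1 x - character 1 x0) * q x"
  shows "fourier_coeff g m = (if m = 0 then 2 * g x0 else 0)
           + (fourier_coeff q (m - 1) - character 1 x0 * fourier_coeff q m)"
proof -
  have "fourier_coeff g m - fourier_coeff (\<lambda>x. g x0) m = fourier_coeff (\<lambda>x. g x - g x0) m"
    by (simp add: fourier_coeff_diff g)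
  also have "\<dots> = integral {-1..1} (\<lambda>x. q x * character (- (m - 1)) x
                                      - character 1 x0 * (q x * character (- m) x))"
    unfolding fourier_coeff_character
  proof (rule integral_cong)
    fix x :: real
    assume "x \<in> {-1..1}"
    then have "(g x - g x0) * character (- m) x
               = (character 1 x - character 1 x0) * q x * character (- m) x"
      by (simp only: gq)
    then show "(g x - g x0) * character (- m) x
               = q x * character (- (m - 1)) x - character 1 x0 * (q x * character (- m) x)"
      using character_add [of 1 "- m" x] by (simp add: algebra_simps)
  qed
  also have "\<dots> = fourier_coeff q (m - 1) - character 1 x0 * fourier_coeff q m"
    unfolding fourier_coeff_character
    by (subst integral_diff)
       (auto intro!: integrable_times_character q integrable_on_mult_right)
  finally show ?thesis
    by (simp add: fourier_coeff_const algebra_simps)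
qed

text \<open>
  After multiplication by \<open>e(x)\<^sup>m\<close>, the twisted difference is the difference of two consecutive
  values of \<open>d(m) e(x)\<^sup>m\<^sup>+\<^sup>1\<close>, where \<open>d(m)\<close> are the coefficients of \<open>q\<close>.
\<close>

lemma fourier_partial_sum_telescope:
  assumes coeff: "\<And>m. fourier_coeff g m = (if m = 0 then c else 0)
           + (fourier_coeff q (m - 1) - character 1 x * fourier_coeff q m)"
  shows "fourier_partial_sum g n x
         = c + fourier_coeff q (- int n - 1) * character (- int n) x
             - fourier_coeff q (int n) * character (int n + 1) x"
proof (induction n)
  case 0
  show ?case
    by (simp add: fourier_partial_sum_character coeff [of 0] algebra_simps)
next
  case (Suc n)
  have "{- int (Suc n)..int (Suc n)} = insert (- int n - 1) (insert (int n + 1) {- int n..int n})"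
    by auto
  then have "fourier_partial_sum g (Suc n) x
      = fourier_coeff g (- int n - 1) * character (- int n - 1) x
        + fourier_coeff g (int n + 1) * character (int n + 1) x + fourier_partial_sum g n x"
    by (simp add: fourier_partial_sum_character)
  moreover have "character (- int n) x = character 1 x * character (- int n - 1) x"
    using character_add [of 1 "- int n - 1" x] by simp
  moreover have "character (int n + 2) x = character 1 x * character (int n + 1) x"
    using character_add [of 1 "int n + 1" x] by (simp add: algebra_simps)
  moreover have "fourier_coeff g (- int n - 1)
      = fourier_coeff q (- int n - 2) - character 1 x * fourier_coeff q (- int n - 1)"
    using coeff [of "- int n - 1"] by (simp add: algebra_simps)
  moreover have "fourier_coeff g (int n + 1)
      = fourier_coeff q (int n) - character 1 x * fourier_coeff q (int n + 1)"
    using coeff [of "int n + 1"] by simp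
  moreover have "- int (Suc n) = - int n - 1" "- int n - 1 - 1 = - int n - 2"
      "int (Suc n) = int n + 1" "int n + 1 + 1 = int n + 2"
    by auto
  ultimately show ?case
    by (simp only: Suc.IH) (simp only: algebra_simps)
qed

lemma fourier_partial_sum_tendsto:
  assumes g: "continuous_on {-1..1} g" and x: "x \<in> {-1<..<1}"
    and D: "(g has_vector_derivative D) (at x)"
  shows "(\<lambda>n. fourier_partial_sum g n x) \<longlonglongrightarrow> 2 * g x"
proof -
  obtain q where q: "continuous_on {-1..1} q"
    and gq: "\<And>y. y \<in> {-1..1} \<Longrightarrow> g y - g x = (character 1 y - character 1 x) * q y"
    using divide_by_character_difference [OF g x D] by blast
  have "filterlim (\<lambda>n. \<bar>- int n - 1\<bar>) at_top sequentially"
    by (rule filterlim_at_top_mono [OF filterlim_int_sequentially]) auto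
  then have "(\<lambda>n. fourier_coeff q (- int n - 1)) \<longlonglongrightarrow> 0"
    by (rule riemann_lebesgue [OF q])
  then have left: "(\<lambda>n. fourier_coeff q (- int n - 1) * character (- int n) x) \<longlonglongrightarrow> 0"
    by (rule tendsto_zero_times_character)
  have "filterlim (\<lambda>n. \<bar>int n\<bar>) at_top sequentially"
    using filterlim_int_sequentially by simp
  then have "(\<lambda>n. fourier_coeff q (int n)) \<longlonglongrightarrow> 0"
    by (rule riemann_lebesgue [OF q])
  then have right: "(\<lambda>n. fourier_coeff q (int n) * character (int n + 1) x) \<longlonglongrightarrow> 0"
    by (rule tendsto_zero_times_character)
  have "(\<lambda>n. 2 * g x + fourier_coeff q (- int n - 1) * character (- int n) x
             - fourier_coeff q (int n) * character (int n + 1) x) \<longlonglongrightarrow> 2 * g x + 0 - 0"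
    by (intro tendsto_intros left right)
  then show ?thesis
    using fourier_partial_sum_telescope [OF fourier_coeff_of_quotient [OF g q gq]] by simp
qed

section \<open>Uniform convergence\<close>

text \<open>
  Smoothness provides derivatives inside the interval and continuous functions on the circle that
  agree with them there. Integration by parts on \<open>[-1,1]\<close> works with the latter, since the
  derivatives themselves carry no information at the endpoints.
\<close>

lemma smooth_on_circle_two_derivatives:
  assumes "smooth_on_circle g"
  obtains g' g'' where "continuous_on_circle g'" "continuous_on_circle g''"
    and "\<And>x. x \<in> {-1<..<1} \<Longrightarrow> (g has_vector_derivative g' x) (at x)"
    and "\<And>x. x \<in> {-1<..<1} \<Longrightarrow> (g' has_vector_derivative g'' x) (at x)"
proof -
  let ?d = "\<lambda>n. nth_vector_derivative n g"
  have d: "(?d n has_vector_derivative ?d (Suc n) x) (at x)" if "x \<in> {-1<..<1}" for n x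
    using assms that
    by (simp add: smooth_on_circle_def nth_vector_derivative_def vector_derivative_works)
  obtain h where h: "\<And>n. continuous_on_circle (h n)" "\<And>n x. x \<in> {-1<..<1} \<Longrightarrow> h n x = ?d n x"
    using assms unfolding smooth_on_circle_def by metis
  have "(g has_vector_derivative h 1 x) (at x)" if "x \<in> {-1<..<1}" for x
    using d [OF that, of 0] h(2) [OF that, of 1] by (simp add: nth_vector_derivative_def)
  moreover have "(h 1 has_vector_derivative h 2 x) (at x)" if "x \<in> {-1<..<1}" for x
    using has_vector_derivative_transform_within_open
        [OF d [OF that, of 1] open_greaterThanLessThan that, of "h 1"] h(2) that
    by (simp add: numeral_2_eq_2)
  ultimately show thesis
    using h(1) that by blast
qed

text \<open>
  The first integration by parts has no boundary term by periodicity; for the second, the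
  decay of the coefficients of \<open>g'\<close> with a bounded boundary term is enough.
\<close>

lemma fourier_coeff_quadratic_decay:
  assumes "smooth_on_circle g"
  obtains C where "\<And>m. (of_int m)\<^sup>2 * norm (fourier_coeff g m) \<le> C"
proof -
  obtain g' g'' where circle: "continuous_on_circle g'" "continuous_on_circle g''"
    and d1: "\<And>x. x \<in> {-1<..<1} \<Longrightarrow> (g has_vector_derivative g' x) (at x)"
    and d2: "\<And>x. x \<in> {-1<..<1} \<Longrightarrow> (g' has_vector_derivative g'' x) (at x)"
    using smooth_on_circle_two_derivatives [OF assms] by blast
  have cont: "continuous_on {-1..1} g" "continuous_on {-1..1} g'" "continuous_on {-1..1} g''"
    and periodic: "g 1 = g (-1)"
    using assms circle by (auto simp: smooth_on_circle_def continuous_on_circle_def)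
  obtain C where C: "\<And>m. \<bar>of_int m\<bar> * norm (fourier_coeff g' m) \<le> C"
    using fourier_coeff_linear_decay [OF cont(2,3) d2] by blast
  show thesis
  proof
    fix m :: int
    have "of_real pi * \<i> * of_int m * fourier_coeff g m = fourier_coeff g' m"
      using fourier_coeff_by_parts [OF cont(1,2) d1, of m] periodic by simp
    then have "norm (of_real pi * \<i> * of_int m * fourier_coeff g m) = norm (fourier_coeff g' m)"
      by simp
    then have parts: "pi * \<bar>of_int m\<bar> * norm (fourier_coeff g m) = norm (fourier_coeff g' m)"
      by (simp add: norm_mult)
    have square: "(real_of_int m)\<^sup>2 = \<bar>of_int m\<bar> * \<bar>of_int m\<bar>"
      by (simp add: power2_eq_square)
    have "(of_int m)\<^sup>2 * norm (fourier_coeff g m) \<le> pi * ((of_int m)\<^sup>2 * norm (fourier_coeff g m))"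
      using pi_ge_two mult_right_mono [of 1 pi "(of_int m)\<^sup>2 * norm (fourier_coeff g m)"] by simp
    also have "\<dots> = \<bar>of_int m\<bar> * (pi * \<bar>of_int m\<bar> * norm (fourier_coeff g m))"
      by (simp only: square mult_ac)
    also have "\<dots> \<le> C"
      unfolding parts by (rule C)
    finally show "(of_int m)\<^sup>2 * norm (fourier_coeff g m) \<le> C" .
  qed
qed

lemma fourier_partial_sum_Suc:
  "fourier_partial_sum g (Suc n) x = fourier_partial_sum g n x
     + (fourier_coeff g (int (Suc n)) * character (int (Suc n)) x
        + fourier_coeff g (- int (Suc n)) * character (- int (Suc n)) x)"
proof -
  have "{- int (Suc n)..int (Suc n)} = insert (- int (Suc n)) (insert (int (Suc n)) {- int n..int n})"
    by auto
  then show ?thesis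
    by (simp add: fourier_partial_sum_character)
qed

lemma fourier_partial_sum_uniform_limit:
  assumes "\<And>m. (of_int m)\<^sup>2 * norm (fourier_coeff g m) \<le> C"
  obtains L where "uniform_limit S (fourier_partial_sum g) L sequentially"
proof -
  \<comment> \<open>The symmetric partial sums are ordinary partial sums of the series with \<open>m\<close> and \<open>-m\<close> paired.\<close>
  define T where "T = (\<lambda>k x. fourier_coeff g (int (Suc k)) * character (int (Suc k)) x
        + fourier_coeff g (- int (Suc k)) * character (- int (Suc k)) x)"
  have sum: "fourier_partial_sum g n x = fourier_coeff g 0 + (\<Sum>k<n. T k x)" for n x
  proof (induction n)
    case (Suc n)
    then show ?case
      by (simp add: fourier_partial_sum_Suc T_def)
  qed (simp add: fourier_partial_sum_character)
  have bound: "norm (fourier_coeff g m) \<le> C / (of_int m)\<^sup>2" if "m \<noteq> 0" for m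
    using assms [of m] that by (simp add: field_simps)
  have "uniform_limit S (\<lambda>n x. \<Sum>k<n. T k x) (\<lambda>x. \<Sum>k. T k x) sequentially"
  proof (rule Weierstrass_m_test)
    fix k x
    have "norm (T k x) \<le> norm (fourier_coeff g (int (Suc k))) + norm (fourier_coeff g (- int (Suc k)))"
      unfolding T_def by (rule order_trans [OF norm_triangle_ineq]) (simp add: norm_mult)
    also have "\<dots> \<le> C / (real (Suc k))\<^sup>2 + C / (real (Suc k))\<^sup>2"
      using bound [of "int (Suc k)"] bound [of "- int (Suc k)"]
      by (intro add_mono) (simp_all add: power2_eq_square algebra_simps)
    finally show "norm (T k x) \<le> 2 * C * inverse ((real (Suc k))\<^sup>2)"
      by (simp add: divide_inverse)
  next
    have "summable (\<lambda>k. inverse ((real k)\<^sup>2))"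
      by (rule inverse_power_summable) auto
    then show "summable (\<lambda>k. 2 * C * inverse ((real (Suc k))\<^sup>2))"
      by (intro summable_mult) (subst summable_Suc_iff)
  qed
  then have "uniform_limit S (\<lambda>n x. fourier_coeff g 0 + (\<Sum>k<n. T k x))
               (\<lambda>x. fourier_coeff g 0 + (\<Sum>k. T k x)) sequentially"
    by (intro uniform_limit_add uniform_limit_const)
  then show thesis
    using that by (simp add: sum [abs_def])
qed

theorem theorem0p2:
  fixes g :: "real \<Rightarrow> complex"
  assumes "smooth_on_circle g"
  shows "(\<forall>x\<in>{-1..1}. convergent (\<lambda>n. fourier_partial_sum g n x) \<and>
            g x = 1/2 * lim (\<lambda>n. fourier_partial_sum g n x)) \<and>
         uniform_limit {-1..1} (fourier_partial_sum g)
            (\<lambda>x. lim (\<lambda>n. fourier_partial_sum g n x)) sequentially"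
proof -
  have g: "continuous_on {-1..1} g"
    using assms by (simp add: smooth_on_circle_def continuous_on_circle_def)
  obtain C where "\<And>m. (of_int m)\<^sup>2 * norm (fourier_coeff g m) \<le> C"
    using fourier_coeff_quadratic_decay [OF assms] by blast
  then obtain L where L: "uniform_limit {-1..1} (fourier_partial_sum g) L sequentially"
    using fourier_partial_sum_uniform_limit by blast
  have L_lim: "(\<lambda>n. fourier_partial_sum g n x) \<longlonglongrightarrow> L x" if "x \<in> {-1..1}" for x
    using tendsto_uniform_limitI [OF L that] .
  have "continuous_on {-1..1} L"
    by (rule uniform_limit_theorem [OF _ L])
       (auto simp: fourier_partial_sum_character [abs_def]
          intro!: always_eventually continuous_intros)
  then have cont: "continuous_on (closure {-1<..<1}) (\<lambda>x. L x - 2 * g x)"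
    by (auto intro!: continuous_intros g)
  have interior: "L x - 2 * g x = 0" if x: "x \<in> {-1<..<1}" for x
  proof -
    have "(g has_vector_derivative vector_derivative g (at x)) (at x)"
      using assms x unfolding smooth_on_circle_def
      by (auto simp: vector_derivative_works [symmetric] nth_vector_derivative_def
               dest!: spec [of _ 0])
    from fourier_partial_sum_tendsto [OF g x this] have "L x = 2 * g x"
      using L_lim [of x] x by (intro LIMSEQ_unique) auto
    then show ?thesis
      by simp
  qed
  have eq: "L x = 2 * g x" if "x \<in> {-1..1}" for x
    using continuous_constant_on_closure [OF cont interior, of x] that by simp
  have lim: "lim (\<lambda>n. fourier_partial_sum g n x) = L x" if "x \<in> {-1..1}" for x
    using limI [OF L_lim [OF that]] .
  have "uniform_limit {-1..1} (fourier_partial_sum g)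
            (\<lambda>x. lim (\<lambda>n. fourier_partial_sum g n x)) sequentially"
    using L by (rule uniform_limit_cong' [THEN iffD1, rotated -1]) (auto simp: lim)
  then show ?thesis
    using eq lim by (auto intro: convergentI [OF L_lim])
qed

end
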